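(* For every finite graph $G$ (loops and multiple edges allowed), $$\theta_G(\beta,0)=(1-\beta)^{n(G)}\beta^{r(G)}\,T_G\!\left(\frac1\beta,\frac{1+\beta}{1-\beta}\right).$$
   Context: Graphs are finite undirected multigraphs; loops and multiple edges are allowed. The degree of a vertex is the number of edge-ends at it (a loop counts twice). A subset $s\subset E$ is identified with the spanning subgraph $(V,s)$, and $d_i(s)$ is the degree of vertex $i$ in $(V,s)$. $k(G)$ is the number of connected components of $G=(V,E)$; $r(G)=|V|-k(G)$ is the rank and $n(G)=|E|-|V|+k(G)$ the nullity; $r(s),n(s)$ refer to $(V,s)$. The polynomials $f_n(x)$, $n\ge 0$, are defined by $f_0(x)=1$, $f_1(x)=0$, $f_{n+1}(x)=x f_n(x)+f_{n-1}(x)$ for $n\ge1$. The graph polynomial $\theta_G$ is $\theta_G(\beta,\gamma):=\sum_{s\subset E}\beta^{|s|}\prod_{i\in V}f_{d_i(s)}(\gamma)$. The Tutte polynomial is $T_G(x,y):=\sum_{s\subset E}(x-1)^{r(G)-r(s)}(y-1)^{n(s)}$. The identity is one of rational functions in $\beta$. *)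

theory Defs
  imports
    "HOL-Library.Multiset"
    "HOL-Computational_Algebra.Polynomial"
    "HOL-Computational_Algebra.Fraction_Field"
begin

text \<open>
  An edge is an abstract name together with the two-element multiset of its ends, so parallel
  edges are distinct names with the same ends, and a loop at \<open>v\<close> has the ends \<open>{#v, v#}\<close>.
\<close>

record ('v, 'e) multigraph =
  verts :: "'v set"
  edges :: "'e set"
  ends :: "'e \<Rightarrow> 'v multiset"

locale finite_multigraph =
  fixes G :: "('v, 'e) multigraph"
  assumes finite_verts: "finite (verts G)"
    and finite_edges: "finite (edges G)"
    and size_ends: "\<And>e. e \<in> edges G \<Longrightarrow> size (ends G e) = 2"
    and ends_in_verts: "\<And>e. e \<in> edges G \<Longrightarrow> set_mset (ends G e) \<subseteq> verts G"

definition spanning :: "('v, 'e) multigraph \<Rightarrow> 'e set \<Rightarrow> ('v, 'e) multigraph" where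
  "spanning G s = G\<lparr>edges := s\<rparr>"

definition vertex_degree :: "('v, 'e) multigraph \<Rightarrow> 'v \<Rightarrow> nat" where
  "vertex_degree G v = (\<Sum>e\<in>edges G. count (ends G e) v)"

definition adjacency :: "('v, 'e) multigraph \<Rightarrow> 'v rel" where
  "adjacency G = {(u, v). \<exists>e\<in>edges G. ends G e = {#u, v#}}"

definition connectedness :: "('v, 'e) multigraph \<Rightarrow> 'v rel" where
  "connectedness G = {(u, v) \<in> verts G \<times> verts G. (u, v) \<in> (adjacency G)\<^sup>*}"

definition components :: "('v, 'e) multigraph \<Rightarrow> 'v set set" where
  "components G = verts G // connectedness G"

definition num_components :: "('v, 'e) multigraph \<Rightarrow> nat" where
  "num_components G = card (components G)"

text \<open>
  The natural-number subtractions in the next two definitions, and the one in the exponent of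
  \<open>x - 1\<close> in \<open>tutte\<close>, are never truncated on finite multigraphs; see the lemmas
  \<open>num_components_le\<close>, \<open>verts_le\<close> and \<open>rank_spanning_le\<close> below.
\<close>

definition rank :: "('v, 'e) multigraph \<Rightarrow> nat" where
  "rank G = card (verts G) - num_components G"

definition nullity :: "('v, 'e) multigraph \<Rightarrow> nat" where
  "nullity G = card (edges G) + num_components G - card (verts G)"

fun f_poly :: "nat \<Rightarrow> 'a::comm_ring_1 \<Rightarrow> 'a" where
  "f_poly 0 x = 1"
| "f_poly (Suc 0) x = 0"
| "f_poly (Suc (Suc n)) x = x * f_poly (Suc n) x + f_poly n x"

definition theta :: "('v, 'e) multigraph \<Rightarrow> 'a::comm_ring_1 \<Rightarrow> 'a \<Rightarrow> 'a" where
  "theta G \<beta> \<gamma> =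
     (\<Sum>s\<in>Pow (edges G). \<beta> ^ card s * (\<Prod>i\<in>verts G. f_poly (vertex_degree (spanning G s) i) \<gamma>))"

definition tutte :: "('v, 'e) multigraph \<Rightarrow> 'a::comm_ring_1 \<Rightarrow> 'a \<Rightarrow> 'a" where
  "tutte G x y =
     (\<Sum>s\<in>Pow (edges G).
        (x - 1) ^ (rank G - rank (spanning G s)) * (y - 1) ^ nullity (spanning G s))"

lemma verts_spanning [simp]: "verts (spanning G s) = verts G"
  and edges_spanning [simp]: "edges (spanning G s) = s"
  and ends_spanning [simp]: "ends (spanning G s) = ends G"
  by (simp_all add: spanning_def)

lemma spanning_edges [simp]: "spanning G (edges G) = G"
  by (simp add: spanning_def)

lemma sym_adjacency: "sym (adjacency G)"
  by (auto simp: adjacency_def sym_def add_mset_commute)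

lemma equiv_connectedness: "equiv (verts G) (connectedness G)"
proof (rule equivI)
  show "connectedness G \<subseteq> verts G \<times> verts G"
    by (auto simp: connectedness_def)
  show "refl_on (verts G) (connectedness G)"
    by (auto simp: refl_on_def connectedness_def)
  show "sym (connectedness G)"
    using sym_rtrancl[OF sym_adjacency, of G] by (auto simp: connectedness_def sym_def)
  show "trans (connectedness G)"
    by (auto simp: connectedness_def trans_def)
qed

lemma finite_multigraph_spanning:
  assumes "finite_multigraph G" and "s \<subseteq> edges G"
  shows "finite_multigraph (spanning G s)"
  using assms by (auto simp: finite_multigraph_def intro: finite_subset)

lemma num_components_le:
  assumes "finite_multigraph G"
  shows "num_components G \<le> card (verts G)"
proof -
  have "components G = (\<lambda>x. connectedness G `` {x}) ` verts G"
    by (auto simp: components_def quotient_def)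
  then show ?thesis
    using assms by (simp add: num_components_def card_image_le finite_multigraph_def)
qed

lemma components_finer:
  fixes G H :: "('v, 'e) multigraph"
  assumes "connectedness G \<subseteq> connectedness H" and "verts G = verts H"
  shows "components H = (\<lambda>C. connectedness H `` C) ` components G"
proof -
  have "connectedness H `` (connectedness G `` {x}) = connectedness H `` {x}"
    if "x \<in> verts G" for x
  proof
    show "connectedness H `` (connectedness G `` {x}) \<subseteq> connectedness H `` {x}"
      using assms equiv_connectedness[of H] by (auto simp: equiv_def dest: transD)
    show "connectedness H `` {x} \<subseteq> connectedness H `` (connectedness G `` {x})"
      using that equiv_class_self[OF equiv_connectedness[of G] that] by auto
  qed
  then have "(\<lambda>C. connectedness H `` C) ` (\<lambda>x. connectedness G `` {x}) ` verts G
      = (\<lambda>x. connectedness H `` {x}) ` verts G"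
    by (simp add: image_image)
  moreover have "components K = (\<lambda>x. connectedness K `` {x}) ` verts K"
    for K :: "('v, 'e) multigraph"
    by (auto simp: components_def quotient_def)
  ultimately show ?thesis
    using assms(2) by simp
qed

lemma connectedness_mono:
  assumes "s \<subseteq> t"
  shows "connectedness (spanning G s) \<subseteq> connectedness (spanning G t)"
proof -
  have "adjacency (spanning G s) \<subseteq> adjacency (spanning G t)"
    using assms by (auto simp: adjacency_def)
  from rtrancl_mono[OF this] show ?thesis
    by (auto simp: connectedness_def)
qed

lemma finite_components:
  assumes "finite_multigraph G"
  shows "finite (components G)"
  using assms by (auto simp: components_def finite_multigraph_def quotient_def)

lemma rank_spanning_le:
  assumes "finite_multigraph G" and "s \<subseteq> edges G"
  shows "rank (spanning G s) \<le> rank G"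
proof -
  have "components G = (\<lambda>C. connectedness G `` C) ` components (spanning G s)"
    using components_finer[of "spanning G s" G] connectedness_mono[OF assms(2), of G] by simp
  then have "num_components G \<le> num_components (spanning G s)"
    using finite_components[OF finite_multigraph_spanning[OF assms]]
    by (simp add: num_components_def card_image_le)
  then show ?thesis
    by (simp add: rank_def)
qed

lemma num_components_insert:
  assumes G: "finite_multigraph G" and sub: "insert e s \<subseteq> edges G"
  shows "num_components (spanning G s) \<le> num_components (spanning G (insert e s)) + 1"
proof -
  let ?R = "connectedness (spanning G s)" and ?R' = "connectedness (spanning G (insert e s))"
  let ?V = "verts G"
  have eqR: "equiv ?V ?R" and eqR': "equiv ?V ?R'"
    using equiv_connectedness[of "spanning G s"] equiv_connectedness[of "spanning G (insert e s)"]
    by simp_all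
  obtain u v where uv: "ends G e = {#u, v#}"
  proof -
    have "size (ends G e) = Suc (Suc 0)"
      using finite_multigraph.size_ends[OF G, of e] sub by simp
    then obtain u N where "ends G e = add_mset u N" "size N = Suc 0"
      using size_eq_Suc_imp_eq_union by fastforce
    then show ?thesis
      using that size_1_singleton_mset[of N] by auto
  qed
  then have V: "u \<in> ?V" "v \<in> ?V"
    using finite_multigraph.ends_in_verts[OF G, of e] sub by simp_all
  let ?D = "?R `` {u} \<union> ?R `` {v}"
  have sym: "(y, x) \<in> ?R" if "(x, y) \<in> ?R" for x y
    using that eqR by (auto simp: equiv_def dest: symD)
  have trans: "(x, z) \<in> ?R" if "(x, y) \<in> ?R" "(y, z) \<in> ?R" for x y z
    using that eqR by (auto simp: equiv_def dest: transD)
  have refl: "(x, x) \<in> ?R" if "x \<in> ?V" for x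
    using that by (simp add: connectedness_def)
  have D_closed: "y \<in> ?D" if "x \<in> ?D" "(x, y) \<in> ?R" for x y
    using that trans[of u x y] trans[of v x y] by auto
  have one_step: "(y, z) \<in> ?R \<or> y \<in> ?D \<and> z \<in> ?D"
    if "(y, z) \<in> adjacency (spanning G (insert e s))" for y z
  proof -
    from that obtain a where a: "a \<in> insert e s" "ends G a = {#y, z#}"
      by (auto simp: adjacency_def)
    then have "y \<in> ?V" "z \<in> ?V"
      using finite_multigraph.ends_in_verts[OF G, of a] sub by auto
    show ?thesis
    proof (cases "a = e")
      case True
      then have "{#y, z#} = {#u, v#}"
        using a uv by simp
      then have "{y, z} = {u, v}"
        by (metis set_mset_add_mset_insert set_mset_empty)
      then show ?thesis
        using refl V by (auto simp: doubleton_eq_iff)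
    next
      case False
      then have "(y, z) \<in> adjacency (spanning G s)"
        using a by (auto simp: adjacency_def)
      then show ?thesis
        using \<open>y \<in> ?V\<close> \<open>z \<in> ?V\<close> by (auto simp: connectedness_def)
    qed
  qed
  have join: "(x, y) \<in> ?R \<or> x \<in> ?D \<and> y \<in> ?D" if "(x, y) \<in> ?R'" for x y
  proof -
    from that have "(x, y) \<in> (adjacency (spanning G (insert e s)))\<^sup>*" and "x \<in> ?V"
      by (auto simp: connectedness_def)
    then show ?thesis
    proof (induction rule: rtrancl_induct)
      case base
      then show ?case using refl by blast
    next
      case (step y z)
      then have "(x, y) \<in> ?R \<or> x \<in> ?D \<and> y \<in> ?D" by blast
      with one_step[OF step.hyps(2)] show ?case
      proof (elim disjE conjE)
        assume "(y, z) \<in> ?R" "(x, y) \<in> ?R"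
        then show ?thesis using trans by blast
      next
        assume "(y, z) \<in> ?R" "x \<in> ?D" "y \<in> ?D"
        then show ?thesis using D_closed by blast
      next
        assume "y \<in> ?D" "z \<in> ?D" "(x, y) \<in> ?R"
        then show ?thesis using D_closed[OF _ sym] by blast
      next
        assume "x \<in> ?D" "z \<in> ?D"
        then show ?thesis by blast
      qed
    qed
  qed
  let ?f = "\<lambda>C. ?R' `` C"
  let ?A = "components (spanning G s) - {?R `` {v}}"
  have f_class: "?f (?R `` {x}) = ?R' `` {x}" if "x \<in> ?V" for x
  proof
    show "?f (?R `` {x}) \<subseteq> ?R' `` {x}"
      using connectedness_mono[of s "insert e s" G] eqR' by (auto simp: equiv_def dest: transD)
    show "?R' `` {x} \<subseteq> ?f (?R `` {x})"
      using refl[OF that] by auto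
  qed
  have "inj_on ?f ?A"
  proof (rule inj_onI)
    fix C D
    assume C: "C \<in> ?A" and D: "D \<in> ?A" and eq: "?f C = ?f D"
    from C obtain x where x: "x \<in> ?V" "C = ?R `` {x}"
      by (auto simp: components_def quotient_def)
    from D obtain y where y: "y \<in> ?V" "D = ?R `` {y}"
      by (auto simp: components_def quotient_def)
    have "(x, y) \<in> ?R'"
      using eq x y f_class eq_equiv_class_iff[OF eqR'] by simp
    moreover have "(v, x) \<notin> ?R" "(v, y) \<notin> ?R"
      using C D x y equiv_class_eq[OF eqR] by auto
    ultimately have "(u, x) \<in> ?R \<and> (u, y) \<in> ?R \<or> (x, y) \<in> ?R"
      using join[of x y] by auto
    then have "(x, y) \<in> ?R"
      using trans[OF sym[of u x], of y] by blast
    then show "C = D"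
      using x y equiv_class_eq[OF eqR] by simp
  qed
  moreover have "?f ` ?A \<subseteq> components (spanning G (insert e s))"
    using components_finer[OF connectedness_mono[of s "insert e s" G]] by auto
  moreover have "finite (components (spanning G (insert e s)))"
    using finite_components[OF finite_multigraph_spanning[OF G sub]] .
  ultimately have "card ?A \<le> num_components (spanning G (insert e s))"
    unfolding num_components_def by (rule card_inj_on_le)
  moreover have "num_components (spanning G s) \<le> card ?A + 1"
    unfolding num_components_def by (auto simp: card_Diff_singleton_if)
  ultimately show ?thesis by simp
qed

lemma verts_le:
  assumes G: "finite_multigraph G"
  shows "card (verts G) \<le> card (edges G) + num_components G"
proof -
  have "card (verts G) \<le> card s + num_components (spanning G s)"
    if "finite s" "s \<subseteq> edges G" for s
    using that
  proof (induction s rule: finite_induct)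
    case empty
    have "adjacency (spanning G {}) = {}"
      by (auto simp: adjacency_def)
    then have "components (spanning G {}) = (\<lambda>x. {x}) ` verts G"
      by (auto simp: components_def quotient_def connectedness_def)
    then show ?case
      by (simp add: num_components_def card_image)
  next
    case (insert e s)
    then show ?case
      using num_components_insert[OF G, of e s] by auto
  qed
  from this[of "edges G"] show ?thesis
    using G by (simp add: finite_multigraph_def)
qed

end

theory Submission
  imports Defs
begin

text \<open>
  Since \<open>f\<^sub>n(0)\<close> is \<open>1\<close> for even \<open>n\<close> and \<open>0\<close> for odd \<open>n\<close>, the left-hand side is the generating
  function \<open>\<Sum> \<beta>\<^bsup>|t|\<^esup>\<close> of the \<^emph>\<open>even\<close> edge sets \<open>t\<close>, those in which all degrees are even
  (\<open>theta_at_zero\<close>).  On the right, \<open>1/\<beta> - 1 = (1-\<beta>)/\<beta>\<close> and \<open>(1+\<beta>)/(1-\<beta>) - 1 = 2\<beta>/(1-\<beta>)\<close>;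
  because rank and nullity add up to the number of edges, the powers collect to
  \<open>\<Sum>\<^sub>s \<beta>\<^bsup>|s|\<^esup> (1-\<beta>)\<^bsup>|E|-|s|\<^esup> 2\<^bsup>n(s)\<^esup>\<close>.

  The factor \<open>2\<^bsup>n(s)\<^esup>\<close> is the number of even subsets of \<open>s\<close> (\<open>card_even_edge_sets\<close>).  Thus the
  right-hand side is a sum over pairs \<open>t \<subseteq> s\<close> with \<open>t\<close> even, and for fixed \<open>t\<close> the binomial theorem
  on \<open>E - t\<close> sums the weights \<open>\<beta>\<^bsup>|s|\<^esup> (1-\<beta>)\<^bsup>|E|-|s|\<^esup>\<close> to \<open>\<beta>\<^bsup>|t|\<^esup>\<close>: if every edge is
  chosen independently with probability \<open>\<beta>\<close>, this is the probability that all of \<open>t\<close> is chosen.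

  To count the even edge sets, evaluate in both orders the double sum
  \<open>\<Sum>\<^sub>t \<Sum>\<^sub>U (-1)\<^bsup>d(t,U)\<^esup>\<close>, where \<open>t \<subseteq> E\<close>, \<open>U \<subseteq> V\<close> and \<open>d(t,U)\<close> counts the ends that edges of \<open>t\<close> have
  in \<open>U\<close>.  The sum over \<open>U\<close> vanishes unless \<open>t\<close> is even, and the sum over \<open>t\<close> vanishes unless no edge
  has exactly one end in \<open>U\<close>, that is, unless \<open>U\<close> is a union of components.  Hence
  \<open>2\<^bsup>|V|\<^esup> \<cdot> #(even sets) = 2\<^bsup>|E|\<^esup> \<cdot> 2\<^bsup>k(G)\<^esup>\<close>.
\<close>

section \<open>Even edge sets\<close>

definition even_edge_sets :: "('v, 'e) multigraph \<Rightarrow> 'e set set" where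
  "even_edge_sets G =
     {t. t \<subseteq> edges G \<and> (\<forall>v\<in>verts G. even (vertex_degree (spanning G t) v))}"

lemma even_edge_sets_spanning:
  assumes "s \<subseteq> edges G"
  shows "even_edge_sets (spanning G s) = {t \<in> even_edge_sets G. t \<subseteq> s}"
  using assms by (auto simp: even_edge_sets_def spanning_def)

lemma finite_even_edge_sets:
  assumes "finite_multigraph G"
  shows "finite (even_edge_sets G)"
  using assms by (auto simp: even_edge_sets_def finite_multigraph_def)

lemma f_poly_zero: "f_poly n (0 :: 'a::comm_ring_1) = (if even n then 1 else 0)"
  by (induction n "0 :: 'a" rule: f_poly.induct) auto

lemma theta_at_zero:
  fixes \<beta> :: "'a::comm_ring_1"
  assumes "finite_multigraph G"
  shows "theta G \<beta> 0 = (\<Sum>t\<in>even_edge_sets G. \<beta> ^ card t)"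
proof -
  have fin: "finite (verts G)" "finite (edges G)"
    using assms by (simp_all add: finite_multigraph_def)
  have weight: "(\<Prod>i\<in>verts G. f_poly (vertex_degree (spanning G t) i) (0::'a))
      = (if \<forall>v\<in>verts G. even (vertex_degree (spanning G t) v) then 1 else 0)" for t
    unfolding f_poly_zero using fin(1) by (auto intro!: prod_zero)
  have "theta G \<beta> 0 = (\<Sum>t\<in>Pow (edges G).
      if \<forall>v\<in>verts G. even (vertex_degree (spanning G t) v) then \<beta> ^ card t else 0)"
    unfolding theta_def weight by (intro sum.cong) auto
  also have "\<dots> = (\<Sum>t\<in>{t \<in> Pow (edges G).
      \<forall>v\<in>verts G. even (vertex_degree (spanning G t) v)}. \<beta> ^ card t)"
    by (rule sum.inter_filter[symmetric]) (simp add: fin)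
  also have "{t \<in> Pow (edges G). \<forall>v\<in>verts G. even (vertex_degree (spanning G t) v)}
      = even_edge_sets G"
    by (auto simp: even_edge_sets_def)
  finally show ?thesis .
qed

section \<open>Vertex sets that split no edge\<close>

text \<open>
  As an edge has two ends, an even number of ends in \<open>U\<close> means both or none; a loop never splits.
\<close>

definition unsplit_sets :: "('v, 'e) multigraph \<Rightarrow> 'v set set" where
  "unsplit_sets G =
     {U. U \<subseteq> verts G \<and> (\<forall>e\<in>edges G. even (\<Sum>v\<in>U. count (ends G e) v))}"

lemma obtain_ends:
  assumes "finite_multigraph G" and "e \<in> edges G"
  obtains u v where "ends G e = {#u, v#}"
proof -
  have "size (ends G e) = Suc (Suc 0)"
    using finite_multigraph.size_ends[OF assms] by simp
  then obtain u N where "ends G e = add_mset u N" "size N = Suc 0"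
    using size_eq_Suc_imp_eq_union by fastforce
  then show ?thesis
    using that size_1_singleton_mset[of N] by auto
qed

lemma sum_count_pair:
  assumes "finite U"
  shows "(\<Sum>x\<in>U. count {#u, v#} x) = of_bool (u \<in> U) + of_bool (v \<in> U)"
proof -
  have "(\<Sum>x\<in>U. count {#u, v#} x)
      = (\<Sum>x\<in>U. (if x = u then 1 else 0) + (if x = v then 1 else 0))"
    by (intro sum.cong) auto
  also have "\<dots> = of_bool (u \<in> U) + of_bool (v \<in> U)"
    using assms by (simp add: sum.distrib)
  finally show ?thesis .
qed

lemma unsplit_sets_iff_adjacency_closed:
  assumes G: "finite_multigraph G"
  shows "unsplit_sets G
    = {U. U \<subseteq> verts G \<and> (\<forall>u v. (u, v) \<in> adjacency G \<longrightarrow> u \<in> U \<longrightarrow> v \<in> U)}"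
proof -
  have "(\<forall>e\<in>edges G. even (\<Sum>v\<in>U. count (ends G e) v))
      \<longleftrightarrow> (\<forall>u v. (u, v) \<in> adjacency G \<longrightarrow> u \<in> U \<longrightarrow> v \<in> U)" (is "?L \<longleftrightarrow> ?R")
    if "U \<subseteq> verts G" for U
  proof -
    have fin: "finite U"
      using that G finite_subset by (auto simp: finite_multigraph_def)
    show ?thesis
    proof
      assume ?L
      then have "even (of_bool (u \<in> U) + of_bool (v \<in> U) :: nat)"
        if "(u, v) \<in> adjacency G" for u v
        using that sum_count_pair[OF fin, of u v] unfolding adjacency_def by force
      then show ?R
        by fastforce
    next
      assume R: ?R
      show ?L
      proof
        fix e assume e: "e \<in> edges G"
        then obtain u v where uv: "ends G e = {#u, v#}"
          using obtain_ends[OF G] by blast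
        then have "(u, v) \<in> adjacency G" "(v, u) \<in> adjacency G"
          using e by (auto simp: adjacency_def add_mset_commute)
        then have "u \<in> U \<longleftrightarrow> v \<in> U"
          using R by blast
        then show "even (\<Sum>v\<in>U. count (ends G e) v)"
          unfolding uv sum_count_pair[OF fin] by simp
      qed
    qed
  qed
  then show ?thesis
    unfolding unsplit_sets_def by blast
qed

lemma unsplit_sets_iff_connectedness_closed:
  assumes G: "finite_multigraph G"
  shows "unsplit_sets G
    = {U. U \<subseteq> verts G \<and> (\<forall>u v. (u, v) \<in> connectedness G \<longrightarrow> u \<in> U \<longrightarrow> v \<in> U)}"
proof -
  have "(\<forall>u v. (u, v) \<in> adjacency G \<longrightarrow> u \<in> U \<longrightarrow> v \<in> U)
      \<longleftrightarrow> (\<forall>u v. (u, v) \<in> connectedness G \<longrightarrow> u \<in> U \<longrightarrow> v \<in> U)" (is "?L \<longleftrightarrow> ?R") for U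
  proof
    assume L: ?L
    have "v \<in> U" if "(u, v) \<in> (adjacency G)\<^sup>*" "u \<in> U" for u v
      using that by (induction rule: rtrancl_induct) (use L in auto)
    then show ?R
      by (auto simp: connectedness_def)
  next
    assume R: ?R
    have "adjacency G \<subseteq> verts G \<times> verts G"
      using finite_multigraph.ends_in_verts[OF G] by (fastforce simp: adjacency_def)
    then have "adjacency G \<subseteq> connectedness G"
      by (auto simp: connectedness_def)
    with R show ?L by blast
  qed
  then show ?thesis
    using unsplit_sets_iff_adjacency_closed[OF G] by simp
qed

text \<open>An unsplit set is a union of components, and the components in this union are unique.\<close>

lemma card_unsplit_sets:
  assumes G: "finite_multigraph G"
  shows "card (unsplit_sets G) = 2 ^ num_components G"
proof -
  let ?R = "connectedness G"
  have eq: "equiv (verts G) ?R"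
    by (rule equiv_connectedness)
  have comp_sub: "C \<subseteq> verts G" if "C \<in> components G" for C
    using that by (auto simp: components_def quotient_def connectedness_def)
  have comp_closed: "v \<in> C" if "C \<in> components G" "u \<in> C" "(u, v) \<in> ?R" for C u v
    using in_quotient_imp_closed[OF eq] that unfolding components_def by blast
  have comp_of: "?R `` {u} \<in> components G" "u \<in> ?R `` {u}" if "u \<in> verts G" for u
    using that equiv_class_self[OF eq that] by (auto simp: components_def quotient_def)
  have bij: "bij_betw Union (Pow (components G)) (unsplit_sets G)"
  proof (rule bij_betw_byWitness[where f' = "\<lambda>U. {C \<in> components G. C \<subseteq> U}"])
    show "\<forall>F\<in>Pow (components G). {C \<in> components G. C \<subseteq> \<Union>F} = F"
    proof (intro ballI equalityI subsetI)
      fix F C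
      assume F: "F \<in> Pow (components G)" and "C \<in> {C \<in> components G. C \<subseteq> \<Union>F}"
      then have C: "C \<in> components G" "C \<subseteq> \<Union>F" by auto
      then have "C \<noteq> {}"
        using in_quotient_imp_non_empty[OF eq] unfolding components_def by blast
      then obtain x D where "x \<in> C" "D \<in> F" "x \<in> D"
        using C by blast
      then have "C = D"
        using quotient_disj[OF eq, of C D] C F unfolding components_def by blast
      with \<open>D \<in> F\<close> show "C \<in> F" by simp
    qed auto
    show "\<forall>U\<in>unsplit_sets G. \<Union>{C \<in> components G. C \<subseteq> U} = U"
    proof (intro ballI equalityI subsetI)
      fix U u assume U: "U \<in> unsplit_sets G" and u: "u \<in> U"
      then have "?R `` {u} \<subseteq> U" "u \<in> verts G"
        unfolding unsplit_sets_iff_connectedness_closed[OF G] by auto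
      then show "u \<in> \<Union>{C \<in> components G. C \<subseteq> U}"
        using comp_of by blast
    qed auto
    show "Union ` Pow (components G) \<subseteq> unsplit_sets G"
      unfolding unsplit_sets_iff_connectedness_closed[OF G]
      using comp_sub comp_closed by blast
  qed auto
  have "card (unsplit_sets G) = card (Pow (components G))"
    using bij_betw_same_card[OF bij] by simp
  then show ?thesis
    using finite_components[OF G] by (simp add: card_Pow num_components_def)
qed

section \<open>Counting even edge sets\<close>

text \<open>
  The sum factors as the product of \<open>1 + (-1)\<^bsup>n x\<^esup>\<close> over \<open>x \<in> A\<close>, and a single odd \<open>n x\<close> kills it.
\<close>

lemma sum_Pow_sign:
  assumes "finite A"
  shows "(\<Sum>X\<in>Pow A. (-1) ^ (\<Sum>x\<in>X. n x) :: int)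
    = (if \<forall>x\<in>A. even (n x) then 2 ^ card A else 0)"
proof -
  have "(\<Sum>X\<in>Pow A. (-1) ^ (\<Sum>x\<in>X. n x) :: int) = (\<Prod>x\<in>A. (-1) ^ n x + 1)"
    using prod_add[OF assms, of "\<lambda>x. (-1) ^ n x :: int" "\<lambda>_. 1"] by (simp add: power_sum)
  also have "\<dots> = (\<Prod>x\<in>A. if even (n x) then 2 else 0)"
    by (intro prod.cong) auto
  also have "\<dots> = (if \<forall>x\<in>A. even (n x) then 2 ^ card A else 0)"
    using assms by (auto intro: prod_zero)
  finally show ?thesis .
qed

lemma sum_Pow_if_const:
  assumes "finite A"
  shows "(\<Sum>X\<in>Pow A. if P X then c else 0 :: int) = c * int (card {X. X \<subseteq> A \<and> P X})"
proof -
  have "(\<Sum>X\<in>Pow A. if P X then c else 0 :: int) = (\<Sum>X\<in>{X \<in> Pow A. P X}. c)"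
    by (rule sum.inter_filter[symmetric]) (simp add: assms)
  also have "{X \<in> Pow A. P X} = {X. X \<subseteq> A \<and> P X}"
    by auto
  finally show ?thesis
    by simp
qed

text \<open>The double sum of signs over edge sets and vertex sets, evaluated in both orders.\<close>

lemma even_unsplit_duality:
  assumes G: "finite_multigraph G"
  shows "2 ^ card (verts G) * card (even_edge_sets G) = 2 ^ card (edges G) * card (unsplit_sets G)"
proof -
  let ?V = "verts G" and ?E = "edges G"
  have fin: "finite ?V" "finite ?E"
    using G by (simp_all add: finite_multigraph_def)
  have "2 ^ card ?V * int (card (even_edge_sets G))
      = (\<Sum>t\<in>Pow ?E. if \<forall>v\<in>?V. even (vertex_degree (spanning G t) v) then 2 ^ card ?V else 0)"
    unfolding sum_Pow_if_const[OF fin(2)] even_edge_sets_def ..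
  also have "\<dots> = (\<Sum>t\<in>Pow ?E. \<Sum>U\<in>Pow ?V. (-1) ^ (\<Sum>v\<in>U. \<Sum>e\<in>t. count (ends G e) v))"
    unfolding sum_Pow_sign[OF fin(1)] by (simp add: vertex_degree_def)
  also have "\<dots> = (\<Sum>U\<in>Pow ?V. \<Sum>t\<in>Pow ?E. (-1) ^ (\<Sum>v\<in>U. \<Sum>e\<in>t. count (ends G e) v))"
    by (rule sum.swap)
  also have "\<dots> = (\<Sum>U\<in>Pow ?V. \<Sum>t\<in>Pow ?E. (-1) ^ (\<Sum>e\<in>t. \<Sum>v\<in>U. count (ends G e) v))"
    by (intro sum.cong refl arg_cong[where f = "\<lambda>k. (-1) ^ k"]) (rule sum.swap)
  also have "\<dots> = (\<Sum>U\<in>Pow ?V. if \<forall>e\<in>?E. even (\<Sum>v\<in>U. count (ends G e) v) then 2 ^ card ?E else 0)"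
    unfolding sum_Pow_sign[OF fin(2)] ..
  also have "\<dots> = 2 ^ card ?E * int (card (unsplit_sets G))"
    unfolding sum_Pow_if_const[OF fin(1)] unsplit_sets_def ..
  finally have "int (2 ^ card ?V * card (even_edge_sets G))
      = int (2 ^ card ?E * card (unsplit_sets G))"
    by simp
  then show ?thesis
    by (simp only: of_nat_eq_iff)
qed

lemma card_even_edge_sets:
  assumes G: "finite_multigraph G"
  shows "card (even_edge_sets G) = 2 ^ nullity G"
proof -
  have "2 ^ card (verts G) * card (even_edge_sets G) = 2 ^ (card (edges G) + num_components G)"
    using even_unsplit_duality[OF G] card_unsplit_sets[OF G] by (simp add: power_add)
  also have "card (edges G) + num_components G = card (verts G) + nullity G"
    using verts_le[OF G] by (simp add: nullity_def)
  finally show ?thesis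
    by (simp add: power_add)
qed

section \<open>The expansion of the Tutte polynomial\<close>

lemma rank_plus_nullity:
  assumes "finite_multigraph G"
  shows "rank G + nullity G = card (edges G)"
  using num_components_le[OF assms] verts_le[OF assms] by (simp add: rank_def nullity_def)

text \<open>
  Write \<open>s = t \<union> X\<close> with \<open>X \<subseteq> E - t\<close>; the sum over \<open>X\<close> is \<open>(b + (1 - b))\<^bsup>|E - t|\<^esup> = 1\<close>.
\<close>

lemma sum_supersets_bernoulli:
  fixes b :: "'a::comm_ring_1"
  assumes "finite E" and "t \<subseteq> E"
  shows "(\<Sum>s | s \<subseteq> E \<and> t \<subseteq> s. b ^ card s * (1 - b) ^ (card E - card s)) = b ^ card t"
proof -
  have fin: "finite t" "finite (E - t)"
    using assms finite_subset by auto
  have "(\<Sum>s | s \<subseteq> E \<and> t \<subseteq> s. b ^ card s * (1 - b) ^ (card E - card s))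
      = (\<Sum>X\<in>Pow (E - t). b ^ card t * (b ^ card X * (1 - b) ^ card (E - t - X)))"
  proof (rule sum.reindex_bij_witness[where i = "\<lambda>X. t \<union> X" and j = "\<lambda>s. s - t"])
    fix s assume s: "s \<in> {s. s \<subseteq> E \<and> t \<subseteq> s}"
    then have "finite s"
      using assms finite_subset by auto
    then have "card s = card t + card (s - t)"
      using s fin card_Diff_subset[of t s] card_mono[of s t] by simp
    moreover have "E - t - (s - t) = E - s"
      using s by auto
    moreover have "card (E - s) = card E - card s"
      using s \<open>finite s\<close> by (simp add: card_Diff_subset)
    ultimately show "b ^ card t * (b ^ card (s - t) * (1 - b) ^ card (E - t - (s - t)))
        = b ^ card s * (1 - b) ^ (card E - card s)"
      by (simp add: power_add mult.assoc)
  qed (use assms in auto)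
  also have "\<dots> = b ^ card t * (\<Sum>X\<in>Pow (E - t). b ^ card X * (1 - b) ^ card (E - t - X))"
    by (simp add: sum_distrib_left)
  also have "(\<Sum>X\<in>Pow (E - t). b ^ card X * (1 - b) ^ card (E - t - X)) = 1"
    using prod_add[OF fin(2), of "\<lambda>_. b" "\<lambda>_. 1 - b"] by simp
  finally show ?thesis by simp
qed

text \<open>
  The prefactor clears all denominators: \<open>s\<close> contributes the exponent \<open>r(G) - (r(G) - r(s)) + n(s) = |s|\<close>
  of \<open>b\<close> and the exponent \<open>n(G) + (r(G) - r(s)) - n(s) = |E| - |s|\<close> of \<open>1 - b\<close>.
\<close>

lemma tutte_expansion:
  fixes b :: "'a::field"
  assumes G: "finite_multigraph G" and b: "b \<noteq> 0" "b \<noteq> 1"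
  shows "(1 - b) ^ nullity G * b ^ rank G * tutte G (1 / b) ((1 + b) / (1 - b))
    = (\<Sum>s\<in>Pow (edges G). b ^ card s * (1 - b) ^ (card (edges G) - card s)
         * 2 ^ nullity (spanning G s))"
proof -
  have b1: "1 - b \<noteq> 0"
    using b by simp
  have x: "1 / b - 1 = (1 - b) / b"
    using b by (simp add: field_simps)
  have y: "(1 + b) / (1 - b) - 1 = 2 * b / (1 - b)"
    using b1 by (simp add: field_simps)
  have summand: "(1 - b) ^ nullity G * b ^ rank G
        * ((1 / b - 1) ^ (rank G - rank (spanning G s))
           * ((1 + b) / (1 - b) - 1) ^ nullity (spanning G s))
      = b ^ card s * (1 - b) ^ (card (edges G) - card s) * 2 ^ nullity (spanning G s)"
    if s: "s \<subseteq> edges G" for s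
  proof -
    let ?n = "nullity (spanning G s)" and ?r = "rank (spanning G s)"
    define d where "d = rank G - ?r"
    have card_s: "?r + ?n = card s"
      using rank_plus_nullity[OF finite_multigraph_spanning[OF G s]] by simp
    have rank_G: "rank G = ?r + d"
      using rank_spanning_le[OF G s] by (simp add: d_def)
    have "card s \<le> card (edges G)"
      using s G by (simp add: card_mono finite_multigraph_def)
    then have rest: "nullity G + d = card (edges G) - card s + ?n"
      using rank_plus_nullity[OF G] card_s rank_G by simp
    have "(1 - b) ^ nullity G * b ^ rank G * (((1 - b) / b) ^ d * (2 * b / (1 - b)) ^ ?n)
        = (1 - b) ^ (nullity G + d) * b ^ (?r + ?n) * 2 ^ ?n / (1 - b) ^ ?n"
      using b b1 unfolding rank_G
      by (simp add: power_add power_divide power_mult_distrib)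
    also have "\<dots> = b ^ card s * (1 - b) ^ (card (edges G) - card s) * 2 ^ ?n"
      unfolding rest card_s using b1 by (simp add: power_add)
    finally show ?thesis
      unfolding x y d_def .
  qed
  show ?thesis
    unfolding tutte_def sum_distrib_left by (intro sum.cong refl summand) auto
qed

text \<open>
  The indeterminate enters the identity only as a field element for which the denominators \<open>b\<close>
  and \<open>1 - b\<close> do not vanish.  Writing \<open>2\<^bsup>n(s)\<^esup>\<close> as a count of even subsets turns the expansion above
  into a sum over pairs, which is then summed over the larger set first.
\<close>

lemma theta_zero_eq_tutte:
  fixes b :: "'a::field"
  assumes G: "finite_multigraph G" and b: "b \<noteq> 0" "b \<noteq> 1"
  shows "theta G b 0 = (1 - b) ^ nullity G * b ^ rank G * tutte G (1 / b) ((1 + b) / (1 - b))"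
proof -
  let ?E = "edges G"
  let ?w = "\<lambda>s. b ^ card s * (1 - b) ^ (card ?E - card s)"
  have fin: "finite ?E"
    using G by (simp add: finite_multigraph_def)
  have "(1 - b) ^ nullity G * b ^ rank G * tutte G (1 / b) ((1 + b) / (1 - b))
      = (\<Sum>s\<in>Pow ?E. ?w s * 2 ^ nullity (spanning G s))"
    by (rule tutte_expansion[OF assms])
  also have "\<dots> = (\<Sum>s\<in>Pow ?E. \<Sum>t | t \<in> even_edge_sets G \<and> t \<subseteq> s. ?w s)"
  proof (intro sum.cong refl)
    fix s assume "s \<in> Pow ?E"
    then have "card {t \<in> even_edge_sets G. t \<subseteq> s} = 2 ^ nullity (spanning G s)"
      using card_even_edge_sets[OF finite_multigraph_spanning[OF G, of s]]
        even_edge_sets_spanning[of s G] by simp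
    then show "?w s * 2 ^ nullity (spanning G s)
        = (\<Sum>t | t \<in> even_edge_sets G \<and> t \<subseteq> s. ?w s)"
      by (simp add: mult.commute)
  qed
  also have "\<dots> = (\<Sum>t\<in>even_edge_sets G. \<Sum>s | s \<in> Pow ?E \<and> t \<subseteq> s. ?w s)"
    by (rule sum.swap_restrict) (simp_all add: fin finite_even_edge_sets[OF G])
  also have "\<dots> = (\<Sum>t\<in>even_edge_sets G. b ^ card t)"
    using sum_supersets_bernoulli[OF fin] by (intro sum.cong) (auto simp: even_edge_sets_def)
  finally show ?thesis
    using theta_at_zero[OF G] by metis
qed

theorem proposition2:
  fixes G :: "('v, 'e) multigraph"
  assumes "finite_multigraph G"
  shows "let \<beta> = Fract [:0, 1:] 1 :: 'a::field poly fract in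
           theta G \<beta> 0 = (1 - \<beta>) ^ nullity G * \<beta> ^ rank G * tutte G (1 / \<beta>) ((1 + \<beta>) / (1 - \<beta>))"
proof -
  have "Fract [:0, 1:] 1 \<noteq> (0 :: 'a poly fract)"
    by (simp add: Zero_fract_def eq_fract)
  moreover have "Fract [:0, 1:] 1 \<noteq> (1 :: 'a poly fract)"
    by (simp add: One_fract_def eq_fract one_pCons)
  ultimately show ?thesis
    unfolding Let_def by (rule theta_zero_eq_tutte[OF assms])
qed

end
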